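(* For any finite word $w$, let $S(w)$ denote the number of distinct square factors of $w$ (the empty word being counted as a square), let $|w|$ denote the length of $w$, and let $|\mathrm{Alph}(w)|$ denote the number of distinct letters occurring in $w$. Then $$S(w)\le |w|-|\mathrm{Alph}(w)|+1.$$
   Context: A word is a finite sequence of symbols $w=w_1w_2\cdots w_n$; its length is $|w|=n$, and $\varepsilon$ denotes the empty word, of length $0$. $\mathrm{Alph}(w)=\{w_i : 1\le i\le n\}$ is the set of letters occurring in $w$. A word $u$ is a factor of $w$ if $w=pus$ for some (possibly empty) words $p,s$. A square is a word of the form $uu$; the empty word $\varepsilon=\varepsilon\varepsilon$ is a square and is counted in $S(w)$, so that $S(w)-1$ is the number of distinct nonempty squares that are factors of $w$. *)

theory Defs
  imports Main "HOL-Library.Sublist"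
begin

text \<open>Words are lists; factors are contiguous sublists (\<^const>\<open>sublist\<close>); the set of letters
  of a word is \<^const>\<open>set\<close>.\<close>

definition square :: "'a list \<Rightarrow> bool" where
  "square v \<longleftrightarrow> (\<exists>u. v = u @ u)"

definition square_factors :: "'a list \<Rightarrow> 'a list set" where
  "square_factors w = {v. sublist v w \<and> square v}"

lemma finite_square_factors: "finite (square_factors w)"
  by (rule finite_subset[of _ "set (sublists w)"]) (auto simp: square_factors_def)

lemma Nil_in_square_factors: "[] \<in> square_factors w"
  by (simp add: square_factors_def square_def)

definition num_squares :: "'a list \<Rightarrow> nat" where
  "num_squares w = card (square_factors w)"

end

theory Submission
  imports Defs "HOL-Library.List_Lexorder"
begin

text \<open>In the Rauzy graph of order \<open>n\<close> of \<open>w\<close>, whose vertices and edges are the factors of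
  length \<open>n\<close> and \<open>n + 1\<close>, a Lyndon word \<open>x\<close> with \<open>|x| \<le> n\<close> spells a circuit of length \<open>|x|\<close> if all
  factors of length \<open>n + 1\<close> of the periodic word \<open>xxx...\<close> are factors of \<open>w\<close>. As \<open>x\<close> is
  unbordered, the edge of this circuit that starts with \<open>x\<close> lies on no other circuit of length at
  most \<open>|x|\<close>. Hence removing these special edges, one per circuit, leaves the graph connected, so
  there are at most \<open>C(n+1) - C(n) + 1\<close> circuits, where \<open>C(n)\<close> counts the factors of length \<open>n\<close>.
  Summing over \<open>1 \<le> n < |w|\<close> gives \<open>|w| - |Alph(w)|\<close>. On the other hand, the number of squares whose
  primitive root is conjugate to \<open>x\<close> is at most the number of \<open>n\<close> for which \<open>x\<close> spells a circuit.\<close>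

section \<open>Periodic words and Lyndon words\<close>

definition periodic_word :: "'a list \<Rightarrow> nat \<Rightarrow> nat \<Rightarrow> 'a list" where
  "periodic_word x j L = map (\<lambda>i. x ! ((j + i) mod length x)) [0..<L]"

lemma length_periodic_word [simp]: "length (periodic_word x j L) = L"
  by (simp add: periodic_word_def)

lemma nth_periodic_word [simp]:
  "i < L \<Longrightarrow> periodic_word x j L ! i = x ! ((j + i) mod length x)"
  by (simp add: periodic_word_def)

lemma take_periodic_word: "n \<le> L \<Longrightarrow> take n (periodic_word x j L) = periodic_word x j n"
  by (rule nth_equalityI) auto

lemma drop_periodic_word: "drop n (periodic_word x j L) = periodic_word x (j + n) (L - n)"
  by (rule nth_equalityI) (auto simp: add.assoc)

lemma periodic_word_cong:
  "a mod length x = b mod length x \<Longrightarrow> periodic_word x a L = periodic_word x b L"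
  by (rule nth_equalityI) (auto intro!: arg_cong[of _ _ "(!) x"] mod_add_cong)

lemma periodic_word_0_length [simp]: "periodic_word x 0 (length x) = x"
  by (rule nth_equalityI) auto

lemma butlast_periodic_word: "butlast (periodic_word x j (Suc n)) = periodic_word x j n"
  by (simp add: butlast_conv_take take_periodic_word)

lemma tl_periodic_word: "tl (periodic_word x j (Suc n)) = periodic_word x (Suc j) n"
  using drop_periodic_word[of 1 x j "Suc n"] by (simp add: drop_Suc)

lemma periodic_word_rotation:
  assumes "d \<le> length x"
  shows "periodic_word x d (length x) = drop d x @ take d x"
proof -
  have "periodic_word x d (length x) = rotate d x"
    by (rule nth_equalityI) (auto simp: nth_rotate)
  then show ?thesis
    using assms by (cases "d = length x") (auto simp: rotate_drop_take)
qed

lemma sublist_periodic_word: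
  assumes "t + L \<le> M" "(a + t) mod length x = b mod length x"
  shows "sublist (periodic_word x b L) (periodic_word x a M)"
proof -
  have "periodic_word x b L = take L (drop t (periodic_word x a M))"
    using assms by (simp add: drop_periodic_word take_periodic_word periodic_word_cong[of "a + t"])
  then show ?thesis
    by (metis sublist_drop sublist_take sublist_order.order.trans)
qed

lemma append_less_append:
  fixes u :: "'a::linorder list"
  assumes "length u = length u'"
  shows "u @ v < u' @ v' \<longleftrightarrow> u < u' \<or> u = u' \<and> v < v'"
  using assms by (induction u u' rule: list_induct2) auto

text \<open>The strict inequality also makes \<open>x\<close> primitive: a proper power equals one
  of its nontrivial rotations.\<close>

definition lyndon :: "'a::linorder list \<Rightarrow> bool" where
  "lyndon x \<longleftrightarrow> x \<noteq> [] \<and> (\<forall>d. 0 < d \<and> d < length x \<longrightarrow> x < periodic_word x d (length x))"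

text \<open>A period \<open>p\<close> gives \<open>x = u @ v = v' @ u\<close> with border
  \<open>u\<close>. Comparing \<open>x\<close> with its rotations \<open>u @ v'\<close> and
  \<open>v @ u\<close> yields \<open>v < v'\<close> and \<open>v' \<le> v\<close>.\<close>

lemma lyndon_unbordered:
  assumes "lyndon x" "0 < p" "p < length x"
    and period: "\<And>i. i + p < length x \<Longrightarrow> x ! i = x ! (i + p)"
  shows False
proof -
  define m where "m = length x"
  define u where "u = drop p x"
  define v where "v = drop (m - p) x"
  define v' where "v' = take p x"
  have u: "u = take (m - p) x"
    unfolding u_def m_def using assms by (intro nth_equalityI) (auto simp: add.commute)
  have x1: "x = u @ v" by (simp add: u v_def)
  have x2: "x = v' @ u" by (simp add: u_def v'_def)
  have "x < u @ v'"
    using assms(1-3) periodic_word_rotation[of p x] unfolding lyndon_def u_def v'_def by (metis less_imp_le)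
  then have 1: "v < v'" using x1 append_less_append[of u u v v'] by simp
  have "x < v @ u"
    using assms(1-3) periodic_word_rotation[of "m - p" x] unfolding lyndon_def u v_def m_def
    by (metis diff_le_self diff_less length_greater_0_conv zero_less_diff)
  then have "v' @ u < v @ u" using x2 by simp
  moreover have "length v' = length v" using assms by (simp add: v_def v'_def m_def)
  ultimately have "v' \<le> v" using append_less_append[of v' v u u] by auto
  with 1 show False by simp
qed

text \<open>As a prefix of the common word, \<open>x\<close> inherits the period
  \<open>length y\<close>; were this below \<open>length x\<close>, then \<open>x\<close> would be
  bordered.\<close>

lemma lyndon_prefix_length_le:
  assumes "lyndon x" "lyndon y" "length x \<le> L"
    and eq: "periodic_word x 0 L = periodic_word y j L"
  shows "length x \<le> length y"
proof (rule ccontr)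
  assume less: "\<not> length x \<le> length y"
  have nth: "x ! i = y ! ((j + i) mod length y)" if "i < length x" for i
    using arg_cong[OF eq, of "\<lambda>l. l ! i"] that assms(3) by simp
  have "x ! i = x ! (i + length y)" if "i + length y < length x" for i
    using nth[of i] nth[of "i + length y"] that by (simp add: add.assoc[symmetric])
  then show False
    using lyndon_unbordered[OF assms(1), of "length y"] assms(2) less by (auto simp: lyndon_def)
qed

text \<open>With equal lengths, \<open>x\<close> and \<open>y\<close> would be nontrivial rotations
  of each other, hence each strictly smaller than the other.\<close>

lemma lyndon_prefix_length_less:
  assumes "lyndon x" "lyndon y" "length x \<le> L" "0 < j" "j < length y"
    and eq: "periodic_word x 0 L = periodic_word y j L"
  shows "length x < length y"
proof (rule ccontr)
  assume "\<not> length x < length y"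
  then have len: "length x = length y"
    using lyndon_prefix_length_le[OF assms(1-3) eq] by simp
  have x: "x = periodic_word y j (length y)"
    using arg_cong[OF eq, of "take (length x)"] assms(3) len by (simp add: take_periodic_word)
       (metis len periodic_word_0_length)
  then have "y < x" using assms by (simp add: lyndon_def)
  have "periodic_word x (length y - j) (length x) = y"
    using periodic_word_rotation[of "length y - j" x] periodic_word_rotation[of j y] x assms(4,5) len
    by simp
  then have "x < y"
    using assms len unfolding lyndon_def by (metis diff_less zero_less_diff less_trans)
  with \<open>y < x\<close> show False by simp
qed

text \<open>This is why a special edge determines its circuit:
  \<open>lyndon_prefix_length_le\<close>, used both ways, forces equal lengths.\<close>

lemma lyndon_prefix_unique:
  assumes "lyndon x" "lyndon y" "length x \<le> L" "length y \<le> L"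
    and eq: "periodic_word x 0 L = periodic_word y 0 L"
  shows "x = y"
proof -
  have "length x = length y"
    using lyndon_prefix_length_le[OF assms(1-3) eq]
      lyndon_prefix_length_le[OF assms(2,1,4) eq[symmetric]] by simp
  then show ?thesis
    using arg_cong[OF eq, of "take (length x)"] assms(3)
    by (metis take_periodic_word periodic_word_0_length)
qed

text \<open>Take \<open>m\<close> the least period of \<open>uuu...\<close> and \<open>x\<close> the
  least window of length \<open>m\<close> in it. Phase and exponent do not depend on
  \<open>r\<close>; \<open>r = 2\<close> is the square of \<open>u\<close>.\<close>

lemma lyndon_root:
  fixes u :: "'a::linorder list"
  assumes "u \<noteq> []"
  obtains x j k where "lyndon x" "0 < k" "\<And>r. periodic_word u 0 (r * length u) = periodic_word x j (r * k * length x)"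
proof -
  define g where "g i = u ! (i mod length u)" for i
  define per where "per p \<longleftrightarrow> 0 < p \<and> (\<forall>i. g (i + p) = g i)" for p
  define m where "m = (LEAST p. per p)"
  have per_len: "per (length u)" using assms by (simp add: per_def g_def)
  have per_m: "per m" unfolding m_def by (rule LeastI[where P = per, OF per_len])
  have m_le: "m \<le> p" if "per p" for p unfolding m_def using that by (rule Least_le)
  have m0: "0 < m" using per_m by (simp add: per_def)
  have g_mult: "g (i + c * m) = g i" for i c
  proof (induction c)
    case (Suc c)
    have "g (i + Suc c * m) = g ((i + c * m) + m)" by (simp add: algebra_simps)
    then show ?case using per_m Suc by (simp add: per_def)
  qed simp
  have g_mod: "g (i mod m) = g i" for i
    using g_mult[of "i mod m" "i div m"] by simp
  have g_cong: "a mod m = b mod m \<Longrightarrow> g a = g b" for a b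
    by (metis g_mod)
  \<comment> \<open>Otherwise the remainder would be a period smaller than \<open>m\<close>.\<close>
  have "length u mod m = 0"
  proof (rule ccontr)
    assume pos: "length u mod m \<noteq> 0"
    have "g (i + length u mod m) = g i" for i
    proof -
      have "g (i + length u mod m) = g (i + length u)"
        by (rule g_cong) (simp add: mod_add_right_eq)
      then show ?thesis using per_len by (simp add: per_def)
    qed
    then have "per (length u mod m)" using pos by (simp add: per_def)
    with m_le m0 show False by (meson leD mod_less_divisor)
  qed
  then obtain k where k: "length u = k * m" by (metis mod_0_imp_dvd dvdE mult.commute)
  have k0: "0 < k" using k assms by (cases k) auto
  define R where "R a = map (\<lambda>i. g (a + i)) [0..<m]" for a
  have R_cong: "a mod m = b mod m \<Longrightarrow> R a = R b" for a b
    unfolding R_def by (auto intro!: g_cong mod_add_cong)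
  have "Min (R ` {..<m}) \<in> R ` {..<m}" using m0 by (intro Min_in) auto
  then obtain a where a: "a < m" "Min (R ` {..<m}) = R a" by auto
  have a_min: "R a \<le> R b" for b
  proof -
    have "R b = R (b mod m)" by (rule R_cong) simp
    also have "R a \<le> \<dots>" unfolding a(2)[symmetric] using m0 by (intro Min_le) auto
    finally show ?thesis .
  qed
  define x where "x = R a"
  have len: "length x = m" by (simp add: x_def R_def)
  have x_nth: "x ! (i mod m) = g (a + i)" for i
    using m0 by (auto simp: x_def R_def intro!: g_cong simp: mod_add_right_eq)
  have rot: "periodic_word x d m = R (a + d)" for d
    by (rule nth_equalityI) (auto simp: R_def x_nth len add.assoc)
  have "lyndon x"
    unfolding lyndon_def
  proof (intro conjI allI impI)
    show "x \<noteq> []" using len m0 by auto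
    fix d assume d: "0 < d \<and> d < length x"
    \<comment> \<open>Equality would make \<open>d < m\<close> a period of \<open>g\<close>.\<close>
    have "R a \<noteq> R (a + d)"
    proof
      assume eq: "R a = R (a + d)"
      have shift: "g (a + i + d) = g (a + i)" for i
      proof -
        have "g (a + d + i mod m) = g (a + i mod m)"
          using arg_cong[OF eq, of "\<lambda>l. l ! (i mod m)"] m0 by (simp add: R_def)
        moreover have "g (a + d + i mod m) = g (a + i + d)"
          by (rule g_cong) (use mod_add_right_eq[of "a + d" i m] in \<open>simp add: ac_simps\<close>)
        moreover have "g (a + i mod m) = g (a + i)"
          by (rule g_cong) (simp add: mod_add_right_eq)
        ultimately show ?thesis by simp
      qed
      have "g (i + d) = g i" for i
      proof -
        \<comment> \<open>\<open>i + m - a\<close> represents \<open>i - a\<close> modulo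
          \<open>m\<close> without truncation, as \<open>a < m\<close>.\<close>
        have "g (i + d) = g (a + (i + m - a) + d)"
        proof (rule g_cong)
          have "a + (i + m - a) + d = (i + d) + m" using a(1) by simp
          then show "(i + d) mod m = (a + (i + m - a) + d) mod m" by (metis mod_add_self2)
        qed
        also have "\<dots> = g (a + (i + m - a))" by (rule shift)
        also have "\<dots> = g i" by (rule g_cong) (use a(1) in simp)
        finally show ?thesis .
      qed
      then have "per d" using d by (simp add: per_def)
      then show False using m_le[of d] d len by simp
    qed
    then show "x < periodic_word x d (length x)"
      using a_min[of "a + d"] by (simp add: len rot) (simp add: x_def)
  qed
  \<comment> \<open>\<open>x\<close> starts at position \<open>a\<close> of \<open>uuu...\<close>,
    so position 0 has phase \<open>m - a\<close> in \<open>xxx...\<close>.\<close>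
  moreover have "periodic_word u 0 (r * length u) = periodic_word x (m - a) (r * k * length x)" for r
  proof (rule nth_equalityI)
    fix i assume i: "i < length (periodic_word u 0 (r * length u))"
    have "x ! ((m - a + i) mod m) = g i"
      unfolding x_nth by (rule g_cong) (use a(1) in simp)
    then show "periodic_word u 0 (r * length u) ! i = periodic_word x (m - a) (r * k * length x) ! i"
      using i by (simp add: k len g_def mult.assoc)
  qed (simp add: k len)
  ultimately show ?thesis using that k0 by blast
qed

section \<open>Rauzy graphs\<close>

text \<open>Connectedness is expressed by labellings: one that is constant along edges is constant
  on \<open>V\<close>. Contracting the edges one at a time loses at most one label per edge, and at
  most one label is left.\<close>

lemma connected_card_le:
  fixes s t :: "'e \<Rightarrow> 'v"
  assumes "finite E" "finite V"
    and conn: "\<And>f :: 'v \<Rightarrow> 'v. (\<And>e. e \<in> E \<Longrightarrow> f (s e) = f (t e)) \<Longrightarrow> (\<And>u v. u \<in> V \<Longrightarrow> v \<in> V \<Longrightarrow> f u = f v)"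
  shows "card V \<le> card E + 1"
proof -
  have "\<exists>f :: 'v \<Rightarrow> 'v. (\<forall>e\<in>E. f (s e) = f (t e)) \<and> card V \<le> card (f ` V) + card E"
    using assms(1)
  proof (induction E)
    case empty
    show ?case by (rule exI[of _ id]) simp
  next
    case (insert e E)
    then obtain f :: "'v \<Rightarrow> 'v"
      where f: "\<forall>e\<in>E. f (s e) = f (t e)" "card V \<le> card (f ` V) + card E"
      by blast
    define g where "g x = (if x = f (s e) then f (t e) else x)" for x
    have "f ` V \<subseteq> insert (f (s e)) ((g \<circ> f) ` V)" by (auto simp: g_def)
    then have "card (f ` V) \<le> card (insert (f (s e)) ((g \<circ> f) ` V))"
      using assms(2) by (intro card_mono) auto
    also have "\<dots> \<le> Suc (card ((g \<circ> f) ` V))" by (rule card_insert_le_m1) auto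
    finally show ?case
      using f insert by (intro exI[of _ "g \<circ> f"]) (auto simp: g_def)
  qed
  then obtain f :: "'v \<Rightarrow> 'v"
    where f: "\<forall>e\<in>E. f (s e) = f (t e)" "card V \<le> card (f ` V) + card E" by blast
  have "\<And>u v. u \<in> V \<Longrightarrow> v \<in> V \<Longrightarrow> f u = f v"
    by (rule conn[of f]) (use f(1) in blast)+
  then have "card (f ` V) \<le> Suc 0"
    using card_le_Suc0_iff_eq[OF finite_imageI[OF assms(2)], of f] by blast
  with f(2) show ?thesis by simp
qed

definition factors :: "'a list \<Rightarrow> nat \<Rightarrow> 'a list set" where
  "factors w n = {v. sublist v w \<and> length v = n}"

text \<open>The orders \<open>n \<ge> |x|\<close> of the Rauzy graphs of \<open>w\<close> that contain the circuit spelled by \<open>x\<close>.\<close>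

definition circuit_orders :: "'a list \<Rightarrow> 'a list \<Rightarrow> nat set" where
  "circuit_orders w x = {n. length x \<le> n \<and> (\<forall>j. sublist (periodic_word x j (Suc n)) w)}"

definition special_edges :: "'a::linorder list \<Rightarrow> nat \<Rightarrow> 'a list set" where
  "special_edges w n = {periodic_word x 0 (Suc n) |x. lyndon x \<and> n \<in> circuit_orders w x}"

lemma finite_factors [simp]: "finite (factors w n)"
  by (rule finite_subset[of _ "set (sublists w)"]) (auto simp: factors_def)

lemma factors_altdef: "factors w n = {take n (drop i w) |i. i + n \<le> length w}"
proof (intro equalityI subsetI)
  fix v assume "v \<in> factors w n"
  then obtain p s where "w = p @ v @ s" "length v = n" by (auto simp: factors_def sublist_def)
  then show "v \<in> {take n (drop i w) |i. i + n \<le> length w}"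
    by (auto intro!: exI[of _ "length p"])
next
  fix v assume "v \<in> {take n (drop i w) |i. i + n \<le> length w}"
  then show "v \<in> factors w n"
    by (auto simp: factors_def) (metis sublist_drop sublist_take sublist_order.order.trans)
qed

lemma special_edges_subset: "special_edges w n \<subseteq> factors w (Suc n)"
  by (auto simp: special_edges_def circuit_orders_def factors_def)

text \<open>A special edge is bypassed by the rest of its circuit, whose own special edges belong to
  shorter circuits.\<close>

lemma special_edge_bypass:
  assumes f: "\<And>e. e \<in> factors w (Suc n) - special_edges w n \<Longrightarrow> f (butlast e) = f (tl e)"
    and "lyndon x" "n \<in> circuit_orders w x"
  shows "f (periodic_word x 0 n) = f (periodic_word x 1 n)"
  using assms(2,3)
proof (induction "length x" arbitrary: x rule: less_induct)
  case less
  have step: "f (periodic_word x j n) = f (periodic_word x (Suc j) n)" if "0 < j" "j < length x" for j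
  proof (cases "periodic_word x j (Suc n) \<in> special_edges w n")
    case False
    moreover have "periodic_word x j (Suc n) \<in> factors w (Suc n)"
      using less.prems by (auto simp: circuit_orders_def factors_def)
    ultimately show ?thesis
      using f[of "periodic_word x j (Suc n)"] by (simp add: butlast_periodic_word tl_periodic_word)
  next
    case True
    then obtain y where y: "lyndon y" "n \<in> circuit_orders w y"
      "periodic_word y 0 (Suc n) = periodic_word x j (Suc n)"
      by (auto simp: special_edges_def)
    \<comment> \<open>A special edge at a phase \<open>j\<close> other than 0 comes from a shorter
      Lyndon word, so the induction hypothesis bypasses it.\<close>
    then have "length y < length x"
      using lyndon_prefix_length_less[OF y(1) less.prems(1) _ that y(3)]
      by (simp add: circuit_orders_def)
    from less.hyps[OF this y(1,2)] show ?thesis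
      using arg_cong[OF y(3), of butlast] arg_cong[OF y(3), of tl]
      by (simp add: butlast_periodic_word tl_periodic_word)
  qed
  \<comment> \<open>Chaining the steps follows the circuit from phase 1 to phase
    \<open>length x\<close>, which is phase 0 again.\<close>
  have "f (periodic_word x 1 n) = f (periodic_word x (Suc j) n)" if "j < length x" for j
    using that
  proof (induction j)
    case (Suc j)
    then show ?case using step[of "Suc j"] by simp
  qed simp
  moreover have "0 < length x" using less.prems by (simp add: lyndon_def)
  ultimately have "f (periodic_word x 1 n) = f (periodic_word x (length x) n)"
    by (metis Suc_pred' diff_less zero_less_one)
  also have "periodic_word x (length x) n = periodic_word x 0 n"
    by (rule periodic_word_cong) simp
  finally show ?case by simp
qed

text \<open>The graph stays connected without its special edges, so it has at most one vertex more
  than remaining edges.\<close>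

lemma card_special_edges:
  "card (special_edges w n) + card (factors w n) \<le> card (factors w (Suc n)) + 1"
proof -
  let ?E = "factors w (Suc n) - special_edges w n"
  have "card (factors w n) \<le> card ?E + 1"
  proof (rule connected_card_le[where s = butlast and t = tl])
    fix f :: "'a list \<Rightarrow> 'a list" and u v
    assume f: "\<And>e. e \<in> ?E \<Longrightarrow> f (butlast e) = f (tl e)"
      and uv: "u \<in> factors w n" "v \<in> factors w n"
    have edge: "f (butlast e) = f (tl e)" if "e \<in> factors w (Suc n)" for e
    proof (cases "e \<in> special_edges w n")
      case True
      then obtain x where x: "lyndon x" "n \<in> circuit_orders w x" "e = periodic_word x 0 (Suc n)"
        by (auto simp: special_edges_def)
      have "f (periodic_word x 0 n) = f (periodic_word x 1 n)"
        using f x(1,2) by (rule special_edge_bypass)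
      then show ?thesis by (simp add: x(3) butlast_periodic_word tl_periodic_word)
    next
      case False
      then show ?thesis using f that by blast
    qed
    \<comment> \<open>Read from left to right, \<open>w\<close> is a walk through all
      vertices.\<close>
    have *: "f (take n (drop i w)) = f (take n w)" if "i + n \<le> length w" for i
      using that
    proof (induction i)
      case (Suc i)
      have "take (Suc n) (drop i w) \<in> factors w (Suc n)"
        using Suc.prems by (auto simp: factors_altdef)
      from edge[OF this] have "f (take n (drop i w)) = f (take n (drop (Suc i) w))"
        using Suc.prems by (simp add: butlast_take tl_take tl_drop drop_Suc)
      then show ?case using Suc by simp
    qed simp
    show "f u = f v" using uv * by (auto simp: factors_altdef)
  qed auto
  moreover have "card ?E = card (factors w (Suc n)) - card (special_edges w n)"
    by (intro card_Diff_subset finite_subset[OF special_edges_subset] special_edges_subset) simp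
  moreover have "card (special_edges w n) \<le> card (factors w (Suc n))"
    by (rule card_mono) (auto simp: special_edges_subset)
  ultimately show ?thesis by simp
qed

text \<open>Telescoping sum of \<open>card_special_edges\<close> over the orders below
  \<open>n\<close>.\<close>

lemma sum_card_special_edges:
  assumes "0 < n"
  shows "(\<Sum>i=1..<n. card (special_edges w i)) + card (factors w 1) \<le> card (factors w n) + (n - 1)"
  using assms
proof (induction n)
  case (Suc n)
  show ?case
  proof (cases "n = 0")
    case False
    then show ?thesis using Suc card_special_edges[of w n] by simp
  qed simp
qed simp

section \<open>Squares and circuits\<close>

text \<open>For Lyndon \<open>x\<close>, these are the nonempty squares in \<open>w\<close> with
  primitive root conjugate to \<open>x\<close>: the even powers of rotations of
  \<open>x\<close>.\<close>

definition squares_with_root :: "'a list \<Rightarrow> 'a list \<Rightarrow> 'a list set" where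
  "squares_with_root w x =
    {v. sublist v w \<and> (\<exists>j k. 0 < k \<and> v = periodic_word x j (2 * k * length x))}"

lemma circuit_orders_less:
  "n \<in> circuit_orders w x \<Longrightarrow> n < length w"
  by (auto simp: circuit_orders_def dest!: spec[of _ 0] dest: sublist_length_le)

text \<open>If \<open>K\<close> is the largest exponent of a square with root \<open>x\<close> and \<open>J\<close> is the set of starting
  phases of the squares with exponent \<open>K\<close>, then those squares contain every factor of length
  \<open>(2K - 1)|x| + |J|\<close> of the periodic word, since \<open>J\<close> meets every cyclic interval of
  \<open>|x| - |J| + 1\<close> phases.\<close>

lemma card_squares_with_root:
  assumes "x \<noteq> []"
  shows "finite (squares_with_root w x) \<and> card (squares_with_root w x) \<le> card (circuit_orders w x)"
proof (cases "squares_with_root w x = {}")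
  case False
  define m where "m = length x"
  have m0: "0 < m" using assms by (simp add: m_def)
  define occ where "occ k j \<longleftrightarrow> sublist (periodic_word x j (2 * k * m)) w" for k j
  define Ks where "Ks = {k. 0 < k \<and> (\<exists>j. occ k j)}"
  have "k \<le> length w" if "k \<in> Ks" for k
  proof -
    from that obtain j where "occ k j" by (auto simp: Ks_def)
    then have "2 * k * m \<le> length w" unfolding occ_def using sublist_length_le by fastforce
    moreover have "k * 1 \<le> k * m" using m0 by (intro mult_le_mono) auto
    ultimately show ?thesis by linarith
  qed
  then have fin: "finite Ks" by (meson finite_nat_set_iff_bounded_le)
  have ne: "Ks \<noteq> {}" using False by (auto simp: squares_with_root_def Ks_def occ_def m_def)
  define K where "K = Max Ks"
  have "K \<in> Ks" unfolding K_def using fin ne by (rule Max_in)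
  then have K0: "0 < K" by (simp add: Ks_def)
  have K_max: "k \<le> K" if "k \<in> Ks" for k unfolding K_def using fin that by (rule Max_ge)
  define J where "J = {j. j < m \<and> occ K j}"
  have finJ: "finite J" by (simp add: J_def)
  have J_le: "card J \<le> m"
    using card_mono[of "{..<m}" J] by (auto simp: J_def)
  \<comment> \<open>Exponents below \<open>K\<close> are counted crudely, \<open>m\<close> phases
    each; only for \<open>K\<close> is the set \<open>J\<close> of actual phases used.\<close>
  define A where "A = (\<lambda>(j, k). periodic_word x j (2 * k * m)) ` ({..<m} \<times> {1..<K})"
  define B where "B = (\<lambda>j. periodic_word x j (2 * K * m)) ` J"
  have sub: "squares_with_root w x \<subseteq> A \<union> B"
  proof
    fix v assume "v \<in> squares_with_root w x"
    then obtain j k where v: "sublist v w" "0 < k" "v = periodic_word x j (2 * k * m)"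
      by (auto simp: squares_with_root_def m_def)
    have v': "v = periodic_word x (j mod m) (2 * k * m)"
      unfolding v(3) by (rule periodic_word_cong) (simp add: m_def)
    have "k \<in> Ks" using v by (auto simp: Ks_def occ_def)
    show "v \<in> A \<union> B"
    proof (cases "k = K")
      case True
      then have "j mod m \<in> J" using v(1) v' m0 by (simp add: J_def occ_def)
      then show ?thesis using v' True by (auto simp: B_def)
    next
      case False
      then have "(j mod m, k) \<in> {..<m} \<times> {1..<K}" using K_max[OF \<open>k \<in> Ks\<close>] v(2) m0 by auto
      then show ?thesis using v' by (force simp: A_def)
    qed
  qed
  have finAB: "finite (A \<union> B)" by (simp add: A_def B_def finJ)
  have "card A \<le> m * (K - 1)"
    unfolding A_def by (rule order.trans[OF card_image_le]) auto
  moreover have "card B \<le> card J"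
    unfolding B_def by (rule card_image_le[OF finJ])
  ultimately have "card (A \<union> B) \<le> m * (K - 1) + card J"
    using card_Un_le[of A B] by simp
  then have 1: "card (squares_with_root w x) \<le> m * (K - 1) + card J"
    using card_mono[OF finAB sub] by simp
  \<comment> \<open>Pigeonhole: the cyclic distances from the elements of \<open>J\<close> to
    \<open>b\<close> are distinct, but only \<open>card J - 1\<close> values lie strictly between
    \<open>m - card J\<close> and \<open>m\<close>.\<close>
  have J_phase: "\<exists>a\<in>J. (b + (m - a)) mod m \<le> m - card J" for b
  proof (rule ccontr)
    assume neg: "\<not> ?thesis"
    let ?h = "\<lambda>a. (b + (m - a)) mod m"
    have inj: "a = a'" if "a \<in> J" "a' \<in> J" "?h a = ?h a'" "a \<le> a'" for a a'
    proof -
      have "m dvd (b + (m - a)) - (b + (m - a'))"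
        using that by (intro mod_eq_dvd_iff_nat[THEN iffD1]) auto
      moreover have "(b + (m - a)) - (b + (m - a')) = a' - a"
        using that by (auto simp: J_def)
      ultimately have "m dvd a' - a" by simp
      moreover have "a' - a < m" using that by (auto simp: J_def)
      ultimately show ?thesis using that(4) by (auto dest: nat_dvd_not_less[rotated])
    qed
    have "inj_on ?h J"
      by (rule inj_onI) (metis inj nle_le)
    then have "card J = card (?h ` J)" by (simp add: card_image)
    also have "\<dots> \<le> card {m - card J<..<m}"
      using neg m0 by (intro card_mono) (auto simp: not_le)
    finally have "card J = 0" using J_le by (simp split: if_splits)
    moreover have "J \<noteq> {}"
    proof -
      from \<open>K \<in> Ks\<close> obtain j where "occ K j" by (auto simp: Ks_def)
      moreover have "periodic_word x j (2 * K * m) = periodic_word x (j mod m) (2 * K * m)"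
        by (rule periodic_word_cong) (simp add: m_def)
      ultimately have "j mod m \<in> J" using m0 by (simp add: J_def occ_def)
      then show ?thesis by blast
    qed
    ultimately show False using finJ by simp
  qed
  \<comment> \<open>An offset of at most \<open>m - card J\<close> and a length \<open>Suc n\<close>
    of at most \<open>(2 * K - 1) * m + card J\<close> fit into \<open>2 * K * m\<close>.\<close>
  have "{m..<(2 * K - 1) * m + card J} \<subseteq> circuit_orders w x"
  proof
    fix n assume n: "n \<in> {m..<(2 * K - 1) * m + card J}"
    have "sublist (periodic_word x b (Suc n)) w" for b
    proof -
      obtain a where a: "a \<in> J" "(b + (m - a)) mod m \<le> m - card J" using J_phase by blast
      have "(2 * K - 1) * m + m = 2 * K * m" using K0 by (cases K) (auto simp: algebra_simps)
      then have "(b + (m - a)) mod m + Suc n \<le> 2 * K * m" using n a(2) J_le by auto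
      moreover have "(a + (b + (m - a)) mod m) mod m = b mod m"
        using a(1) by (simp add: J_def mod_add_right_eq)
      ultimately have "sublist (periodic_word x b (Suc n)) (periodic_word x a (2 * K * m))"
        by (intro sublist_periodic_word) (auto simp: m_def)
      then show ?thesis
        using a(1) by (auto simp: J_def occ_def intro: sublist_order.order.trans)
    qed
    then show "n \<in> circuit_orders w x" using n by (simp add: circuit_orders_def m_def)
  qed
  moreover have "finite (circuit_orders w x)"
    by (rule finite_subset[of _ "{..<length w}"]) (auto dest: circuit_orders_less)
  ultimately have "card {m..<(2 * K - 1) * m + card J} \<le> card (circuit_orders w x)"
    by (intro card_mono)
  then have "(2 * K - 1) * m + card J - m \<le> card (circuit_orders w x)" by simp
  moreover have "m * (K - 1) + card J \<le> (2 * K - 1) * m + card J - m"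
    using K0 by (cases K) (auto simp: algebra_simps)
  ultimately show ?thesis using 1 finite_subset[OF sub finAB] by simp
qed auto

text \<open>Indexing by factors of \<open>w\<close> keeps the union finite. The root is such a
  factor because the square spans at least two periods and so contains every rotation of it.\<close>

lemma square_factors_subset:
  fixes w :: "'a::linorder list"
  shows "square_factors w - {[]} \<subseteq> (\<Union>x\<in>{x. lyndon x \<and> sublist x w}. squares_with_root w x)"
proof
  fix v assume v: "v \<in> square_factors w - {[]}"
  then obtain u where u: "v = u @ u" "u \<noteq> []" "sublist v w"
    by (auto simp: square_factors_def square_def)
  obtain x k j where x: "lyndon x" "0 < k"
    "\<And>r. periodic_word u 0 (r * length u) = periodic_word x j (r * k * length x)"
    by (rule lyndon_root[OF u(2)]) blast
  have "v = periodic_word u 0 (2 * length u)"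
    unfolding u(1) by (rule nth_equalityI) (auto simp: nth_append le_mod_geq not_less)
  then have v_eq: "v = periodic_word x j (2 * k * length x)" using x(3)[of 2] by simp
  let ?m = "length x"
  have m0: "0 < ?m" using x(1) by (simp add: lyndon_def)
  have "sublist (periodic_word x 0 ?m) v"
    unfolding v_eq
  proof (rule sublist_periodic_word)
    have "?m + ?m \<le> 2 * k * ?m" using x(2) by (cases k) auto
    then show "(?m - j mod ?m) + ?m \<le> 2 * k * ?m"
      using diff_le_self[of ?m "j mod ?m"] by linarith
    have "(j + (?m - j mod ?m)) mod ?m = (j mod ?m + (?m - j mod ?m)) mod ?m"
      by (simp add: mod_add_left_eq)
    also have "\<dots> = 0" using m0 by simp
    finally show "(j + (?m - j mod ?m)) mod ?m = 0 mod ?m" by simp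
  qed
  then have "sublist x w" using u(3) by (metis periodic_word_0_length sublist_order.order.trans)
  then show "v \<in> (\<Union>x\<in>{x. lyndon x \<and> sublist x w}. squares_with_root w x)"
    using x(1,2) u(3) v_eq by (auto simp: squares_with_root_def)
qed

lemma card_circuits_le_special_edges:
  "card {x \<in> {x. lyndon x \<and> sublist x w}. n \<in> circuit_orders w x} \<le> card (special_edges w n)"
proof (rule card_inj_on_le[where f = "\<lambda>x. periodic_word x 0 (Suc n)"])
  show "inj_on (\<lambda>x. periodic_word x 0 (Suc n)) {x \<in> {x. lyndon x \<and> sublist x w}. n \<in> circuit_orders w x}"
    by (rule inj_onI, rule lyndon_prefix_unique[where L = "Suc n"]) (auto simp: circuit_orders_def)
  show "finite (special_edges w n)"
    using special_edges_subset finite_factors by (rule finite_subset)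
qed (auto simp: special_edges_def)

section \<open>Double counting of Lyndon words and orders\<close>

lemma card_square_factors_linorder:
  fixes w :: "'a::linorder list"
  shows "card (square_factors w) + card (set w) \<le> length w + 1"
proof (cases "w = []")
  case True
  then have "square_factors w = {[]}" by (auto simp: square_factors_def square_def)
  with True show ?thesis by simp
next
  case False
  define X where "X = {x. lyndon x \<and> sublist x w}"
  have finX: "finite X"
    by (rule finite_subset[of _ "set (sublists w)"]) (auto simp: X_def)
  have ord: "circuit_orders w x = {n \<in> {1..<length w}. n \<in> circuit_orders w x}" if "x \<in> X" for x
    using that by (auto simp: X_def lyndon_def circuit_orders_less)
      (auto simp: circuit_orders_def Suc_le_eq intro: order.strict_trans2)
  have sq: "finite (squares_with_root w x)"
    "card (squares_with_root w x) \<le> card (circuit_orders w x)" if "x \<in> X" for x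
    using card_squares_with_root[of x w] that by (auto simp: X_def lyndon_def)
  have "card (square_factors w - {[]}) \<le> card (\<Union>x\<in>X. squares_with_root w x)"
    using square_factors_subset[of w] finX sq by (intro card_mono) (auto simp: X_def)
  also have "\<dots> \<le> (\<Sum>x\<in>X. card (squares_with_root w x))"
    by (rule card_UN_le[OF finX])
  also have "\<dots> \<le> (\<Sum>x\<in>X. card {n \<in> {1..<length w}. n \<in> circuit_orders w x})"
    by (intro sum_mono) (use sq(2) ord in auto)
  also have "\<dots> = (\<Sum>n=1..<length w. card {x \<in> X. n \<in> circuit_orders w x})"
    by (rule sum_multicount_gen) (use finX in auto)
  also have "\<dots> \<le> (\<Sum>n=1..<length w. card (special_edges w n))"
    unfolding X_def by (intro sum_mono card_circuits_le_special_edges)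
  finally have 1: "card (square_factors w - {[]}) \<le> (\<Sum>n=1..<length w. card (special_edges w n))" .
  \<comment> \<open>The two ends of the telescoped sum: one factor of full length, and one factor of
    length 1 per letter.\<close>
  have "factors w (length w) = {w}"
    by (auto simp: factors_altdef)
  moreover have "factors w 1 = (\<lambda>a. [a]) ` set w"
  proof (intro equalityI subsetI)
    fix v assume "v \<in> factors w 1"
    then show "v \<in> (\<lambda>a. [a]) ` set w"
      by (cases v) (auto simp: factors_def dest: set_mono_sublist)
  next
    fix v assume "v \<in> (\<lambda>a. [a]) ` set w"
    then show "v \<in> factors w 1"
      by (auto simp: factors_def sublist_def dest: split_list)
  qed
  then have "card (factors w 1) = card (set w)" by (simp add: card_image inj_on_def)
  ultimately have "card (square_factors w - {[]}) + card (set w) \<le> 1 + (length w - 1)"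
    using 1 sum_card_special_edges[of "length w" w] False by simp
  then show ?thesis
    using False Nil_in_square_factors[of w] finite_square_factors[of w]
    by (simp add: card_Diff_singleton)
qed

theorem theorem1:
  fixes w :: "'a list"
  shows "int (num_squares w) \<le> int (length w) - int (card (set w)) + 1"
proof -
  \<comment> \<open>Lyndon words need a linear order on the letters, so these are encoded
    injectively as naturals; squares and alphabet size survive this.\<close>
  obtain h :: "'a \<Rightarrow> nat" where h: "inj_on h (set w)"
    using finite_imp_inj_to_nat_seg[of "set w"] by auto
  have "inj_on (map h) (square_factors w)"
  proof (rule inj_onI)
    fix u v assume "u \<in> square_factors w" "v \<in> square_factors w" "map h u = map h v"
    then show "u = v"
      using inj_on_subset[OF h, of "set u \<union> set v"]
      by (auto simp: square_factors_def dest: set_mono_sublist intro: map_inj_on)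
  qed
  moreover have "map h ` square_factors w \<subseteq> square_factors (map h w)"
    by (auto simp: square_factors_def square_def intro: map_mono_sublist)
  ultimately have "card (square_factors w) \<le> card (square_factors (map h w))"
    by (meson card_inj_on_le finite_square_factors)
  moreover have "card (set (map h w)) = card (set w)" using h by (simp add: card_image)
  ultimately show ?thesis
    using card_square_factors_linorder[of "map h w"] by (simp add: num_squares_def)
qed

end
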